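(* (i) Let $A_5$ be the alternating group on $\{0,1,2,3,4\}$, let $a=(0\ 1)(2\ 3)$, $b=(0\ 1\ 2\ 3\ 4)$, and $S=(a,b,b^{-1})$. Then $\chi_1(A_5,S)=3$. (ii) Let $\operatorname{PSL}_2(\mathbb{F}_7)=\operatorname{SL}_2(\mathbb{F}_7)/\{\pm I\}$ act on the projective line $\mathbb{P}^1(\mathbb{F}_7)=\mathbb{F}_7\cup\{\infty\}$ by projective transformations, let $a,b\in\operatorname{PSL}_2(\mathbb{F}_7)$ be the elements acting by $a(x)=-1/x$ and $b(x)=x+1$, and let $S=(a,b,b^{-1})$. Then $\chi_1(\operatorname{PSL}_2(\mathbb{F}_7),S)=4$.
   Context: For a finite group $G$ and an ordered generating tuple $S=(s_1,\ldots,s_r)$ of distinct nonidentity elements, the one-step separating alphabet number $\chi_1(G,S)$ is the least integer $q\geq 2$ such that there exists a labelling $f:G\to[q]=\{0,1,\ldots,q-1\}$ for which the map $g\mapsto (f(g),f(gs_1),\ldots,f(gs_r))$ is injective on $G$. In each of the two cases above, $S$ generates the stated group. *)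

theory Defs
  imports
    "HOL-Algebra.Coset"
    "HOL-Analysis.Determinants"
    "HOL-Combinatorics.Cycles"
    "Berlekamp_Zassenhaus.Finite_Field"
begin

section \<open>The one-step separating alphabet number\<close>

text \<open>
  The alphabet \<open>[q]\<close> is \<open>{0..<q}\<close>. The definition makes sense for an arbitrary tuple \<open>S\<close>, so the
  side conditions on \<open>S\<close> (generating, distinct nonidentity entries) are not built in.
  For finite \<open>G\<close> the minimum exists, since an injective labelling is always admissible.
\<close>

definition separating_labelling ::
    "('a, 'm) monoid_scheme \<Rightarrow> 'a list \<Rightarrow> nat \<Rightarrow> ('a \<Rightarrow> nat) \<Rightarrow> bool" where
  "separating_labelling G S q f \<longleftrightarrow>
     f \<in> carrier G \<rightarrow> {0..<q} \<and>
     inj_on (\<lambda>g. (f g, map (\<lambda>s. f (g \<otimes>\<^bsub>G\<^esub> s)) S)) (carrier G)"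

definition chi1 :: "('a, 'm) monoid_scheme \<Rightarrow> 'a list \<Rightarrow> nat" where
  "chi1 G S = (LEAST q. 2 \<le> q \<and> (\<exists>f. separating_labelling G S q f))"


section \<open>Alternating groups\<close>

text \<open>
  The library's \<open>alt_group n\<close> acts on \<open>{1..n}\<close>; here the set acted on is a parameter.
  Products are composed from right to left. The opposite convention gives the opposite group, which
  inversion identifies with the original one, replacing \<open>S\<close> by the tuple of inverses; for the tuples
  \<open>(a, b, b\<^sup>-\<^sup>1)\<close> with \<open>a\<close> an involution this only permutes the entries.
\<close>

definition alt_on :: "'a set \<Rightarrow> ('a \<Rightarrow> 'a) monoid" where
  "alt_on X = \<lparr> carrier = {p. p permutes X \<and> evenperm p}, monoid.mult = (\<circ>), one = id \<rparr>"


section \<open>Projective special linear groups of degree two\<close>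

definition SL2 :: "('k::field ^ 2 ^ 2) monoid" where
  "SL2 = \<lparr> carrier = {A. det A = 1}, monoid.mult = (**), one = mat 1 \<rparr>"

definition PSL2 :: "('k::field ^ 2 ^ 2) set monoid" where
  "PSL2 = SL2 Mod {mat 1, - mat 1}"

text \<open>The projective line is \<open>'k option\<close>, with \<open>None\<close> as the point at infinity.\<close>

fun moebius :: "'k::field ^ 2 ^ 2 \<Rightarrow> 'k option \<Rightarrow> 'k option" where
  "moebius A None = (if A$2$1 = 0 then None else Some (A$1$1 / A$2$1))"
| "moebius A (Some x) =
     (if A$2$1 * x + A$2$2 = 0 then None
      else Some ((A$1$1 * x + A$1$2) / (A$2$1 * x + A$2$2)))"

text \<open>The induced action of a coset; all members of a coset agree (see \<open>PSL2_act_coset\<close>).\<close>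

definition PSL2_act :: "('k::field ^ 2 ^ 2) set \<Rightarrow> 'k option \<Rightarrow> 'k option" where
  "PSL2_act C x = the_elem ((\<lambda>A. moebius A x) ` C)"

definition PSL2_elt :: "('k::field option \<Rightarrow> 'k option) \<Rightarrow> ('k ^ 2 ^ 2) set" where
  "PSL2_elt \<phi> = (THE C. C \<in> carrier PSL2 \<and> PSL2_act C = \<phi>)"

fun neg_recip :: "'k::field option \<Rightarrow> 'k option" where
  "neg_recip None = Some 0"
| "neg_recip (Some x) = (if x = 0 then None else Some (- 1 / x))"

fun plus_one :: "'k::field option \<Rightarrow> 'k option" where
  "plus_one None = None"
| "plus_one (Some x) = Some (x + 1)"

lemma carrier_PSL2: "carrier PSL2 = {{A, - A} | A :: 'k::field ^ 2 ^ 2. det A = 1}"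
proof -
  have neg: "(- mat 1) ** A = - A" for A :: "'k ^ 2 ^ 2"
    by (simp add: vec_eq_iff matrix_matrix_mult_def mat_def sum_2 forall_2)
  have "{mat 1, - mat 1} #>\<^bsub>SL2\<^esub> A = {A, - A}" for A :: "'k ^ 2 ^ 2"
    by (auto simp: r_coset_def SL2_def neg)
  then show ?thesis
    by (auto simp: PSL2_def FactGroup_def RCOSETS_def SL2_def)
qed

lemma moebius_uminus: "moebius (- A) x = moebius A x"
proof (cases x)
  case (Some t)
  have *: "- (A$2$1 * t) - A$2$2 = - (A$2$1 * t + A$2$2)"
    "- (A$1$1 * t) - A$1$2 = - (A$1$1 * t + A$1$2)" by simp_all
  show ?thesis using Some by (simp only: moebius.simps vector_uminus_component
      mult_minus_left add_uminus_conv_diff * neg_equal_0_iff_equal minus_divide_divide)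
qed simp

lemma PSL2_act_coset: "PSL2_act {A, - A} = moebius A"
  by (auto simp: PSL2_act_def moebius_uminus)

lemma ex1_PSL2I:
  fixes W :: "'k::field ^ 2 ^ 2"
  assumes "det W = 1" "moebius W = \<phi>"
    and uniq: "\<And>A. det A = 1 \<Longrightarrow> moebius A = \<phi> \<Longrightarrow> A = W \<or> A = - W"
  shows "\<exists>!C. C \<in> carrier PSL2 \<and> PSL2_act C = \<phi>"
proof (rule ex1I[of _ "{W, - W}"])
  show "{W, - W} \<in> carrier PSL2 \<and> PSL2_act {W, - W} = \<phi>"
    using assms(1,2) by (auto simp: carrier_PSL2 PSL2_act_coset)
next
  fix C assume C: "C \<in> carrier PSL2 \<and> PSL2_act C = \<phi>"
  then obtain A where A: "C = {A, - A}" "det A = 1" by (auto simp: carrier_PSL2)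
  with C have "moebius A = \<phi>" by (simp add: PSL2_act_coset)
  with A(2) have "A = W \<or> A = - W" by (rule uniq)
  then show "C = {W, - W}" using A(1) by auto
qed

text \<open>The two definite descriptions used in the theorem are well defined.\<close>

lemma ex1_neg_recip: "\<exists>!C. C \<in> carrier PSL2 \<and> PSL2_act C = (neg_recip :: 'k::field option \<Rightarrow> _)"
proof -
  define W :: "'k ^ 2 ^ 2" where "W = vector [vector [0, - 1], vector [1, 0]]"
  have W: "W$1$1 = 0" "W$1$2 = - 1" "W$2$1 = 1" "W$2$2 = 0"
    by (simp_all add: W_def)
  have "moebius W x = neg_recip x" for x
    by (cases x) (simp_all add: W)
  moreover have "det W = 1" by (simp add: det_2 W)
  moreover have "A = W \<or> A = - W" if "det A = 1" "moebius A = neg_recip" for A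
  proof -
    have 1: "moebius A None = Some 0" "moebius A (Some 0) = None" "moebius A (Some 1) = Some (- 1)"
      by (simp_all add: that)
    have 2: "A$1$1 = 0" "A$2$2 = 0" "A$2$1 \<noteq> 0" "A$1$2 = - A$2$1"
      using 1 by (auto split: if_splits simp: field_simps)
    then have "A$2$1 * A$2$1 = 1" using that(1) by (simp add: det_2)
    then have "A$2$1 = 1 \<or> A$2$1 = - 1" by (simp add: square_eq_1_iff)
    then show ?thesis using 2 by (auto simp: vec_eq_iff forall_2 W)
  qed
  ultimately show ?thesis by (intro ex1_PSL2I[of W]) auto
qed

lemma ex1_plus_one: "\<exists>!C. C \<in> carrier PSL2 \<and> PSL2_act C = (plus_one :: 'k::field option \<Rightarrow> _)"
proof -
  define T :: "'k ^ 2 ^ 2" where "T = vector [vector [1, 1], vector [0, 1]]"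
  have T: "T$1$1 = 1" "T$1$2 = 1" "T$2$1 = 0" "T$2$2 = 1"
    by (simp_all add: T_def)
  have "moebius T x = plus_one x" for x
    by (cases x) (simp_all add: T)
  moreover have "det T = 1" by (simp add: det_2 T)
  moreover have "A = T \<or> A = - T" if "det A = 1" "moebius A = plus_one" for A
  proof -
    have 1: "moebius A None = None" "moebius A (Some 0) = Some 1" "moebius A (Some 1) = Some (1 + 1)"
      by (simp_all add: that)
    have 2: "A$2$1 = 0" "A$2$2 \<noteq> 0" "A$1$2 = A$2$2"
      using 1(1,2) by (auto split: if_splits)
    have "A$1$1 = A$2$2"
      using 1(3) 2 by (auto simp: field_simps split: if_splits)
    with 2 have "A$2$2 * A$2$2 = 1" using that(1) by (simp add: det_2)
    then have "A$2$2 = 1 \<or> A$2$2 = - 1" by (simp add: square_eq_1_iff)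
    then show ?thesis using 2 \<open>A$1$1 = A$2$2\<close> by (auto simp: vec_eq_iff forall_2 T)
  qed
  ultimately show ?thesis by (intro ex1_PSL2I[of T]) auto
qed


section \<open>The field with seven elements\<close>

text \<open>\<open>'p mod_ring\<close> is the ring of integers modulo \<open>CARD('p)\<close>, a field if \<open>CARD('p)\<close> is prime.\<close>

typedef seven = "{0..<7::nat}" by (rule exI[of _ 0]) simp

lemma card_seven: "CARD(seven) = 7"
  using type_definition.card[OF type_definition_seven] by simp

instance seven :: prime_card
  by standard (simp add: card_seven)

type_synonym F7 = "seven mod_ring"

end

theory Submission
  imports Defs
begin

text \<open>
  For \<open>r\<close> generators there are only \<open>q\<^sup>r\<^sup>+\<^sup>1\<close> patterns, and \<open>2\<^sup>4 < 60\<close>, \<open>3\<^sup>4 < 168\<close>. The labellings that attain the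
  resulting lower bounds were found by simulated annealing; they are given by tables, and the
  distinctness of their 60 and 168 patterns is checked by rewriting.
\<close>

section \<open>Pigeonhole lower bound\<close>

lemma card_le_of_separating_labelling:
  assumes "separating_labelling G S q f" "\<And>g s. g \<in> carrier G \<Longrightarrow> s \<in> set S \<Longrightarrow> g \<otimes>\<^bsub>G\<^esub> s \<in> carrier G"
  shows "card (carrier G) \<le> q ^ Suc (length S)"
proof -
  define W where "W = {ws. set ws \<subseteq> {0..<q} \<and> length ws = Suc (length S)}"
  define \<pi> where "\<pi> = (\<lambda>g. f g # map (\<lambda>s. f (g \<otimes>\<^bsub>G\<^esub> s)) S)"
  have "inj_on \<pi> (carrier G)" "\<pi> ` carrier G \<subseteq> W"
    using assms unfolding separating_labelling_def \<pi>_def W_def inj_on_def Pi_def by auto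
  moreover have "finite W" "card W = q ^ Suc (length S)"
    unfolding W_def by (simp_all only: finite_lists_length_eq card_lists_length_eq
        finite_atLeastLessThan card_atLeastLessThan diff_zero)
  ultimately show ?thesis using card_inj_on_le by metis
qed

text \<open>Since \<open>n ^ Suc (length S)\<close> grows with \<open>n\<close>, one strict
  comparison at \<open>q\<close> excludes every alphabet of at most \<open>q\<close> letters, and
  \<open>f\<close> attains the next size.\<close>

lemma chi1_eqI:
  assumes f: "separating_labelling G S (Suc q) f"
    and card: "q ^ Suc (length S) < card (carrier G)"
    and "1 \<le> q"
    and closed: "\<And>g s. g \<in> carrier G \<Longrightarrow> s \<in> set S \<Longrightarrow> g \<otimes>\<^bsub>G\<^esub> s \<in> carrier G"
  shows "chi1 G S = Suc q"
  unfolding chi1_def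
proof (rule Least_equality)
  show "2 \<le> Suc q \<and> (\<exists>f. separating_labelling G S (Suc q) f)" using assms by auto
next
  fix n assume "2 \<le> n \<and> (\<exists>f. separating_labelling G S n f)"
  then have "card (carrier G) \<le> n ^ Suc (length S)"
    using card_le_of_separating_labelling closed by blast
  with card have "q ^ Suc (length S) < n ^ Suc (length S)" by simp
  then show "Suc q \<le> n" by (simp add: power_less_imp_less_base Suc_leI del: power_Suc)
qed

section \<open>The labelling of A5 and an enumeration of even permutations\<close>

text \<open>
  The label of \<open>p\<close> is \<open>table5 ! p 0 ! p 1 ! p 2\<close>: an even permutation is determined by these three
  values. Entries whose indices are not distinct are never consulted.
\<close>

definition table5 :: "nat list list list" where
  "table5 =
    [[[0,0,0,0,0],[0,0,2,2,1],[0,2,0,1,1],[0,1,1,0,2],[0,1,2,0,0]],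
     [[0,0,2,0,1],[0,0,0,0,0],[0,0,0,0,2],[1,0,0,0,2],[2,0,1,0,0]],
     [[0,2,0,1,1],[2,0,0,1,1],[0,0,0,0,0],[2,2,0,0,0],[0,0,0,0,0]],
     [[0,2,1,0,1],[0,0,0,0,0],[0,0,0,0,1],[0,0,0,0,0],[2,1,0,0,0]],
     [[0,0,2,0,0],[1,0,2,0,0],[1,0,0,2,0],[2,1,0,0,0],[0,0,0,0,0]]]"

text \<open>The index triples are the images of 0, 1, 2 under the identity, \<open>a\<close>,
  \<open>b\<close> and the inverse of \<open>b\<close>: the label of \<open>g \<circ> s\<close> is
  read from the values of \<open>g\<close> at \<open>s 0\<close>, \<open>s 1\<close>,
  \<open>s 2\<close>.\<close>

definition pattern5 :: "nat list \<Rightarrow> nat list" where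
  "pattern5 v = (let f = (\<lambda>i j k. table5 ! (v ! i) ! (v ! j) ! (v ! k))
     in [f 0 1 2, f 1 0 3, f 1 2 3, f 4 0 1])"

text \<open>Executable stand-in for the sign of the permutation with values \<open>v\<close>.\<close>

definition vandermonde5 :: "nat list \<Rightarrow> int" where
  "vandermonde5 v = (let d = (\<lambda>i j. int (v ! j) - int (v ! i))
     in d 0 1 * (d 0 2 * d 1 2) * (d 0 3 * d 1 3 * d 2 3) * (d 0 4 * d 1 4 * d 2 4 * d 3 4))"

text \<open>Five rounds starting from \<open>[[]]\<close> list the one-line notations of all 120
  permutations of five points.\<close>

definition extend5 :: "nat list list \<Rightarrow> nat list list" where
  "extend5 vs = [i # v. v \<leftarrow> vs, i \<leftarrow> [0..<5], i \<notin> set v]"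

definition even5 :: "nat list list" where
  "even5 = [v. v \<leftarrow> extend5 (extend5 (extend5 (extend5 (extend5 [[]])))), 0 < vandermonde5 v]"

lemma table5_less: "\<forall>i\<in>{..<5}. \<forall>j\<in>{..<5}. \<forall>k\<in>{..<5}. table5 ! i ! j ! k < 3"
  by code_simp

lemma distinct_pattern5: "distinct (map pattern5 even5)"
  by code_simp

lemma Cons_mem_extend5: "i # v \<in> set (extend5 vs) \<longleftrightarrow> i < 5 \<and> i \<notin> set v \<and> v \<in> set vs"
  by (auto simp: extend5_def split: if_splits)

text \<open>A transposition permutes the ten unordered index pairs and reverses the orientation of
  an odd number of them, so the product of differences changes sign.\<close>

lemma vandermonde5_transpose:
  assumes "a < 5" "b < 5" "a \<noteq> b"
  shows "vandermonde5 (map (p \<circ> Transposition.transpose a b) [0..<5]) = - vandermonde5 (map p [0..<5])"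
proof -
  define d where "d = (\<lambda>i j. int (p j) - int (p i))"
  have anti: "d j i = - d i j" for i j by (simp add: d_def)
  \<comment> \<open>Only pairs in decreasing order are rewritten; \<open>anti\<close> itself would
    loop as a simplification rule.\<close>
  have flip: "d 1 0 = - d 0 1" "d 2 0 = - d 0 2" "d 3 0 = - d 0 3" "d 4 0 = - d 0 4"
    "d 2 1 = - d 1 2" "d 3 1 = - d 1 3" "d 4 1 = - d 1 4"
    "d 3 2 = - d 2 3" "d 4 2 = - d 2 4" "d 4 3 = - d 3 4"
    by (rule anti)+
  \<comment> \<open>Stated for a generic index map \<open>t\<close>, so that the same expansion
    serves the transposition and, with \<open>t = id\<close>, the right-hand side.\<close>
  have v: "vandermonde5 (map (p \<circ> t) [0..<5]) = d (t 0) (t 1) * (d (t 0) (t 2) * d (t 1) (t 2)) *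
    (d (t 0) (t 3) * d (t 1) (t 3) * d (t 2) (t 3)) *
    (d (t 0) (t 4) * d (t 1) (t 4) * d (t 2) (t 4) * d (t 3) (t 4))" for t
    by (simp add: vandermonde5_def d_def numeral_2_eq_2 del: upt_Suc)
  have "a \<in> {0, 1, 2, 3, 4}" "b \<in> {0, 1, 2, 3, 4}" using assms by auto
  then have "vandermonde5 (map (p \<circ> Transposition.transpose a b) [0..<5]) = - vandermonde5 (map (p \<circ> id) [0..<5])"
    unfolding v using \<open>a \<noteq> b\<close>
    by (elim insertE emptyE; simp add: Transposition.transpose_def flip[unfolded One_nat_def])
  then show ?thesis by simp
qed

text \<open>The constant is the value at the identity, 1! 2! 3! 4! = 288; both sides change sign
  with each transposition composed on the right.\<close>

lemma vandermonde5_eq: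
  assumes "p permutes {..<5}"
  shows "vandermonde5 (map p [0..<5]) = 288 * sign p"
  using finite_lessThan assms
proof (induction p rule: permutes_rev_induct)
  case id
  show ?case by (simp add: vandermonde5_def)
next
  case (swap a b p)
  have "permutation p" using permutes_imp_permutation[OF finite_lessThan] swap.hyps by blast
  then have "sign (p \<circ> Transposition.transpose a b) = - sign p"
    using swap.hyps by (subst sign_compose) (auto simp: permutation_swap_id sign_swap_id)
  with swap show ?case
    using vandermonde5_transpose[of a b p] by (simp add: o_def)
qed

lemma mem_even5:
  assumes "p permutes {..<5}" "evenperm p"
  shows "map p [0..<5] \<in> set even5"
proof -
  have lt: "p i < 5 \<longleftrightarrow> i < 5" for i using permutes_in_image[OF assms(1), of i] by simp
  have inj: "p i = p j \<longleftrightarrow> i = j" for i j using permutes_inj[OF assms(1)] by (simp add: inj_eq)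
  \<comment> \<open>With the entries explicit, \<open>Cons_mem_extend5\<close> peels off one letter
    at a time and leaves only bounds and injectivity of \<open>p\<close>.\<close>
  have "map p [0..<5] = [p 0, p 1, p 2, p 3, p 4]" by (simp add: upt_rec eval_nat_numeral)
  then have "map p [0..<5] \<in> set (extend5 (extend5 (extend5 (extend5 (extend5 [[]])))))"
    by (simp add: Cons_mem_extend5 lt inj)
  moreover have "0 < vandermonde5 (map p [0..<5])"
    using vandermonde5_eq assms by (simp add: sign_def)
  ultimately show ?thesis by (auto simp: even5_def)
qed

section \<open>Order and monoid structure of alternating groups\<close>

lemma card_alt_on:
  assumes "finite X" "x \<in> X" "y \<in> X" "x \<noteq> y"
  shows "fact (card X) \<le> 2 * card (carrier (alt_on X))"
proof -
  let ?E = "carrier (alt_on X)" and ?\<tau> = "Transposition.transpose x y"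
  have \<tau>: "?\<tau> permutes X" using assms by (simp add: permutes_swap_id)
  \<comment> \<open>An odd permutation \<open>p\<close> is \<open>?\<tau>\<close> composed with the
    even permutation \<open>?\<tau> \<circ> p\<close>, so two copies of the alternating group cover
    the symmetric group.\<close>
  have "{p. p permutes X} \<subseteq> ?E \<union> (\<circ>) ?\<tau> ` ?E"
  proof
    fix p assume "p \<in> {p. p permutes X}"
    then have p: "p permutes X" by simp
    then have "?\<tau> \<circ> p permutes X" using \<tau> permutes_compose by blast
    moreover have "evenperm (?\<tau> \<circ> p) \<longleftrightarrow> \<not> evenperm p"
      using assms(4) evenperm_comp[OF permutation_swap_id permutes_imp_permutation[OF assms(1) p]]
      by (simp add: evenperm_swap)
    moreover have "p = ?\<tau> \<circ> (?\<tau> \<circ> p)" by (simp add: fun_eq_iff)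
    ultimately show "p \<in> ?E \<union> (\<circ>) ?\<tau> ` ?E" using p unfolding alt_on_def
      by (cases "evenperm p") auto
  qed
  moreover have "finite ?E"
    by (rule finite_subset[OF _ finite_permutations[OF assms(1)]]) (auto simp: alt_on_def)
  ultimately have "card {p. p permutes X} \<le> card ?E + card ?E"
    by (meson card_image_le card_mono card_Un_le finite_UnI finite_imageI add_left_mono order_trans)
  then show ?thesis using card_permutations[OF refl assms(1)] by simp
qed

lemma monoid_alt_on:
  assumes "finite X" shows "monoid (alt_on X)"
proof (rule monoidI)
  fix p q assume "p \<in> carrier (alt_on X)" "q \<in> carrier (alt_on X)"
  then have "p permutes X" "q permutes X" "evenperm p" "evenperm q" by (simp_all add: alt_on_def)
  then show "p \<otimes>\<^bsub>alt_on X\<^esub> q \<in> carrier (alt_on X)"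
    using evenperm_comp[of p q] assms by (simp add: alt_on_def permutes_compose permutes_imp_permutation)
qed (auto simp: alt_on_def permutes_id comp_assoc)

section \<open>The value for A5\<close>

lemma chi1_alt5:
  defines "a \<equiv> cycle_of_list [0, 1] \<circ> cycle_of_list [2, 3]"
    and "b \<equiv> cycle_of_list [0, 1, 2, 3, 4]"
  shows "chi1 (alt_on {..<5 :: nat}) [a, b, inv\<^bsub>alt_on {..<5}\<^esub> b] = 3"
proof -
  let ?G = "alt_on {..<5 :: nat}"
  \<comment> \<open>\<open>cycle_of_list\<close> unfolds \<open>b\<close> into adjacent
    transpositions; the same factors in reverse order give its inverse.\<close>
  define b' :: "nat \<Rightarrow> nat" where
    "b' = Transposition.transpose 3 4 \<circ> Transposition.transpose 2 3 \<circ> Transposition.transpose 1 2 \<circ>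
      Transposition.transpose 0 1"
  interpret monoid ?G by (rule monoid_alt_on) simp
  have tr: "Transposition.transpose i j permutes {..<5}" if "i < 5" "j < 5" for i j :: nat
    using that by (simp add: permutes_swap_id)
  have perm: "a permutes {..<5}" "b permutes {..<5}" "b' permutes {..<5}"
    unfolding a_def b_def b'_def cycle_of_list.simps comp_id
    by (intro permutes_compose tr; simp)+
  have even: "evenperm a" "evenperm b" "evenperm b'"
    unfolding a_def b_def b'_def cycle_of_list.simps comp_id
    by (simp_all add: evenperm_comp permutation_compose permutation_swap_id evenperm_swap)
  have carrier: "a \<in> carrier ?G" "b \<in> carrier ?G" "b' \<in> carrier ?G"
    using perm even by (auto simp: alt_on_def)
  have val: "a 0 = 1" "a 1 = 0" "a 2 = 3" "b 0 = 1" "b 1 = 2" "b 2 = 3" "b' 0 = 4" "b' 1 = 0" "b' 2 = 1"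
    by (simp_all add: a_def b_def b'_def Transposition.transpose_def)
  have "b \<circ> b' = id" "b' \<circ> b = id"
    by (simp_all add: b_def b'_def fun_eq_iff)
  then have inv: "inv\<^bsub>?G\<^esub> b = b'"
    using inv_unique'[OF carrier(2,3)] by (simp add: alt_on_def)
  define f where "f = (\<lambda>p :: nat \<Rightarrow> nat. table5 ! p 0 ! p 1 ! p 2)"
  have pattern: "f g # map (\<lambda>s. f (g \<otimes>\<^bsub>?G\<^esub> s)) [a, b, b'] = pattern5 (map g [0..<5])" for g
    by (simp add: f_def alt_on_def val[unfolded One_nat_def numeral_2_eq_2] pattern5_def numeral_2_eq_2)
  have "separating_labelling ?G [a, b, b'] (Suc 2) f"
    unfolding separating_labelling_def
  proof (intro conjI inj_onI funcsetI)
    fix g assume "g \<in> carrier ?G"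
    then have "g i < 5" if "i < 5" for i
      using permutes_in_image[of g "{..<5}" i] that by (simp add: alt_on_def)
    then show "f g \<in> {0..<Suc 2}" using table5_less unfolding f_def by simp
  next
    fix g h assume gh: "g \<in> carrier ?G" "h \<in> carrier ?G"
      and "(f g, map (\<lambda>s. f (g \<otimes>\<^bsub>?G\<^esub> s)) [a, b, b']) = (f h, map (\<lambda>s. f (h \<otimes>\<^bsub>?G\<^esub> s)) [a, b, b'])"
    then have "pattern5 (map g [0..<5]) = pattern5 (map h [0..<5])"
      unfolding pattern[symmetric] by simp
    moreover have "inj_on pattern5 (set even5)" using distinct_pattern5 by (simp add: distinct_map)
    ultimately have "map g [0..<5] = map h [0..<5]"
      using gh mem_even5 by (auto simp: alt_on_def dest: inj_onD)
    then have "g i = h i" if "i < 5" for i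
      using that by simp
    moreover have "g i = h i" if "\<not> i < 5" for i
      using gh that by (auto simp: alt_on_def permutes_def)
    ultimately show "g = h" by blast
  qed
  \<comment> \<open>The covering bound gives 120 \<le> 2 |G|, so |G| is at least 60, above 2^4 =
    16.\<close>
  moreover have "2 ^ Suc (length [a, b, b']) < card (carrier ?G)"
    using card_alt_on[of "{..<5::nat}" 0 1] by (simp add: fact_numeral)
  ultimately have "chi1 ?G [a, b, b'] = Suc 2" by (rule chi1_eqI) (use carrier in auto)
  then show ?thesis unfolding inv by simp
qed

section \<open>The labelling of PSL2(F7) in terms of residues\<close>

text \<open>
  A coset \<open>{A, - A}\<close> is represented by the member whose lower left entry \<open>z\<close>, or upper left entry \<open>x\<close> if
  \<open>z = 0\<close>, lies in \<open>{1, 2, 3}\<close>. Given this first column, the matrix is determined by its lower right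
  entry if \<open>z \<noteq> 0\<close>, and by its upper right entry if \<open>z = 0\<close>.
\<close>

definition table7 :: "nat list list list" where
  "table7 =
    [[[],[1,0,1,0,0,0,3],[2,3,2,0,0,0,3],[3,1,3,2,2,2,3]],
     [[1,3,3,3,0,1,1],[3,1,1,3,1,0,0],[0,3,0,0,2,0,0],[2,2,3,2,0,1,2],[1,2,0,1,1,0,3],[0,2,3,0,3,0,3],[1,1,0,2,1,3,3]],
     [[0,1,0,0,1,2,0],[1,2,1,3,3,0,2],[1,3,0,3,3,2,3],[2,3,3,0,1,3,3],[3,1,1,0,1,3,3],[1,2,0,0,2,2,1],[2,2,3,0,0,0,2]],
     [[1,2,3,3,2,2,2],[2,2,2,2,2,0,3],[0,3,3,0,1,0,1],[2,3,0,0,2,1,1],[2,2,3,0,0,3,1],[1,0,0,2,1,0,1],[2,1,2,1,2,3,1]]]"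

text \<open>The outer \<open>mod\<close> sends 0 to 0 rather than to 7.\<close>

definition neg7 :: "nat \<Rightarrow> nat" where "neg7 n = (7 - n) mod 7"

definition normal7 :: "nat \<Rightarrow> nat \<Rightarrow> bool" where
  "normal7 x z \<longleftrightarrow> z \<in> {1,2,3} \<or> z = 0 \<and> x \<in> {1,2,3}"

text \<open>The second branch looks up the negated matrix, so that both members of a coset receive
  one label.\<close>

definition label7 :: "nat \<Rightarrow> nat \<Rightarrow> nat \<Rightarrow> nat \<Rightarrow> nat" where
  "label7 x y z w =
    (if normal7 x z then table7 ! z ! x ! (if z = 0 then y else w)
     else table7 ! neg7 z ! neg7 x ! (if z = 0 then neg7 y else neg7 w))"

text \<open>The four arguments are the entries of A, Aa, Ab and A times the inverse of b, where a
  has rows (0, -1), (1, 0) and b has rows (1, 1), (0, 1).\<close>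

definition pattern7 :: "nat \<times> nat \<times> nat \<times> nat \<Rightarrow> nat list" where
  "pattern7 = (\<lambda>(x, y, z, w).
    [label7 x y z w, label7 y (neg7 x) w (neg7 z),
     label7 x ((x + y) mod 7) z ((z + w) mod 7),
     label7 x ((y + neg7 x) mod 7) z ((w + neg7 z) mod 7)])"

text \<open>One representative per coset: 147 with nonzero \<open>z\<close> and 21 with
  \<open>z = 0\<close>, 168 in all. The determinant condition is arranged to avoid subtraction of
  naturals.\<close>

definition matrices7 :: "(nat \<times> nat \<times> nat \<times> nat) list" where
  "matrices7 = [(x, y, z, w).
     z \<leftarrow> [0..<4], x \<leftarrow> [0..<7], normal7 x z, y \<leftarrow> [0..<7], w \<leftarrow> [0..<7],
     (x * w) mod 7 = (1 + y * z) mod 7]"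

lemma mem_matrices7I:
  assumes "x < 7" "y < 7" "z < 4" "w < 7" "normal7 x z" "(x * w) mod 7 = (1 + y * z) mod 7"
  shows "(x, y, z, w) \<in> set matrices7"
  unfolding matrices7_def set_concat set_map image_image
  using assms by (intro UN_I[of z] UN_I[of x]) simp_all

lemma label7_less: "list_all (\<lambda>(x, y, z, w). label7 x y z w < 4) matrices7"
  by code_simp

lemma distinct_pattern7: "distinct (map pattern7 matrices7)"
  by code_simp

lemma neg7_neg7: "n < 7 \<Longrightarrow> neg7 (neg7 n) = n"
  by (cases "n = 0") (simp_all add: neg7_def)

lemma neg7_eq_0_iff: "n < 7 \<Longrightarrow> neg7 n = 0 \<longleftrightarrow> n = 0"
  by (cases "n = 0") (simp_all add: neg7_def)

lemma neg7_mem_iff: "n < 7 \<Longrightarrow> n \<noteq> 0 \<Longrightarrow> neg7 n \<in> {1, 2, 3} \<longleftrightarrow> n \<notin> {1, 2, 3}"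
  by (auto simp: neg7_def)

text \<open>Negation fixes 0 and swaps {1, 2, 3} with {4, 5, 6}, so exactly one of a nonzero first
  column and its negative is normal.\<close>

lemma normal7_neg7:
  assumes "x < 7" "z < 7" "x \<noteq> 0 \<or> z \<noteq> 0"
  shows "normal7 (neg7 x) (neg7 z) \<longleftrightarrow> \<not> normal7 x z"
  unfolding normal7_def
  using assms neg7_mem_iff[of x] neg7_mem_iff[of z] neg7_eq_0_iff[of z] by (cases "z = 0") simp_all

lemma label7_neg7:
  assumes "x < 7" "y < 7" "z < 7" "w < 7" "x \<noteq> 0 \<or> z \<noteq> 0"
  shows "label7 (neg7 x) (neg7 y) (neg7 z) (neg7 w) = label7 x y z w"
  using assms by (simp add: label7_def normal7_neg7 neg7_neg7 neg7_eq_0_iff)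

section \<open>Matrix arithmetic in PSL2 over a field\<close>

definition mat2 :: "'k \<Rightarrow> 'k \<Rightarrow> 'k \<Rightarrow> 'k \<Rightarrow> 'k::zero ^ 2 ^ 2" where
  "mat2 x y z w = vector [vector [x, y], vector [z, w]]"

lemma mat2_nth [simp]:
  "mat2 x y z w $ 1 $ 1 = x" "mat2 x y z w $ 1 $ 2 = y"
  "mat2 x y z w $ 2 $ 1 = z" "mat2 x y z w $ 2 $ 2 = w"
  by (simp_all add: mat2_def)

lemma mult_mat2_nth:
  "(A ** mat2 x y z w) $ i $ 1 = A $ i $ 1 * x + A $ i $ 2 * z"
  "(A ** mat2 x y z w) $ i $ 2 = A $ i $ 1 * y + A $ i $ 2 * w"
  by (simp_all add: matrix_matrix_mult_def sum_2)

lemma minus_matrix_mult: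
  fixes A B :: "'k::ring_1 ^ 'n ^ 'n"
  shows "(- A) ** B = - (A ** B)" "A ** (- B) = - (A ** B)"
  by (simp_all add: matrix_matrix_mult_def vec_eq_iff sum_negf)

lemma PSL2_mult: "{A, - A} \<otimes>\<^bsub>PSL2\<^esub> {B, - B} = {A ** B, - (A ** B)}"
  by (auto simp: PSL2_def FactGroup_def set_mult_def SL2_def minus_matrix_mult)

lemma PSL2_one: "\<one>\<^bsub>PSL2\<^esub> = {mat 1, - mat 1}"
  by (simp add: PSL2_def FactGroup_def)

lemma PSL2_carrierI: "det A = 1 \<Longrightarrow> {A, - A} \<in> carrier PSL2"
  by (auto simp: carrier_PSL2)

lemma PSL2_carrierE:
  assumes "C \<in> carrier PSL2"
  obtains A where "C = {A, - A}" "det A = 1"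
  using assms by (auto simp: carrier_PSL2)

text \<open>This supplies the closure under products and the uniqueness of inverses used below; each
  law reduces to matrix algebra on representatives.\<close>

lemma monoid_PSL2: "monoid (PSL2 :: ('k::field ^ 2 ^ 2) set monoid)"
proof (rule monoidI)
  fix C D E :: "('k ^ 2 ^ 2) set"
  assume C: "C \<in> carrier PSL2" and D: "D \<in> carrier PSL2"
  show "C \<otimes>\<^bsub>PSL2\<^esub> D \<in> carrier PSL2"
    using C D by (elim PSL2_carrierE) (simp add: PSL2_mult PSL2_carrierI det_mul)
  assume E: "E \<in> carrier PSL2"
  show "C \<otimes>\<^bsub>PSL2\<^esub> D \<otimes>\<^bsub>PSL2\<^esub> E = C \<otimes>\<^bsub>PSL2\<^esub> (D \<otimes>\<^bsub>PSL2\<^esub> E)"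
    using C D E by (elim PSL2_carrierE) (simp add: PSL2_mult matrix_mul_assoc)
next
  show "\<one>\<^bsub>PSL2\<^esub> \<in> carrier PSL2" by (simp add: PSL2_one PSL2_carrierI)
qed (auto simp: PSL2_one PSL2_mult elim!: PSL2_carrierE)

lemma PSL2_elt_eqI:
  assumes "\<exists>!C. C \<in> carrier PSL2 \<and> PSL2_act C = \<phi>" "det A = 1" "moebius A = \<phi>"
  shows "PSL2_elt \<phi> = {A, - A}"
  unfolding PSL2_elt_def using assms
  by (intro the1_equality) (simp_all add: PSL2_carrierI PSL2_act_coset)

lemma PSL2_elt_neg_recip: "PSL2_elt neg_recip = {mat2 0 (- 1) 1 0, - mat2 0 (- 1) 1 0}"
proof (rule PSL2_elt_eqI[OF ex1_neg_recip])
  show "moebius (mat2 0 (- 1) 1 0 :: 'a ^ 2 ^ 2) = neg_recip"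
  proof
    fix x :: "'a option" show "moebius (mat2 0 (- 1) 1 0) x = neg_recip x" by (cases x) simp_all
  qed
qed (simp add: det_2)

lemma PSL2_elt_plus_one: "PSL2_elt plus_one = {mat2 1 1 0 1, - mat2 1 1 0 1}"
proof (rule PSL2_elt_eqI[OF ex1_plus_one])
  show "moebius (mat2 1 1 0 1 :: 'a ^ 2 ^ 2) = plus_one"
  proof
    fix x :: "'a option" show "moebius (mat2 1 1 0 1) x = plus_one x" by (cases x) simp_all
  qed
qed (simp add: det_2)

lemma inv_PSL2_elt_plus_one:
  "inv\<^bsub>PSL2\<^esub> {mat2 1 1 0 1, - mat2 1 1 0 1 :: 'k::field ^ 2 ^ 2} = {mat2 1 (- 1) 0 1, - mat2 1 (- 1) 0 1}"
proof -
  interpret monoid "PSL2 :: ('k ^ 2 ^ 2) set monoid" by (rule monoid_PSL2)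
  have "mat2 1 1 0 1 ** mat2 1 (- 1) 0 1 = (mat 1 :: 'k ^ 2 ^ 2)"
    "mat2 1 (- 1) 0 1 ** mat2 1 1 0 1 = (mat 1 :: 'k ^ 2 ^ 2)"
    by (simp_all add: vec_eq_iff forall_2 mult_mat2_nth mat_def)
  then show ?thesis
    by (intro inv_unique'[symmetric] PSL2_carrierI) (simp_all add: PSL2_mult PSL2_one det_2)
qed

text \<open>Counts only matrices with nonzero upper left entry \<open>x\<close>: there
  \<open>x\<close>, \<open>y\<close>, \<open>z\<close> are free and determine the last entry. A
  coset has at most two members, in characteristic two just one.\<close>

lemma card_PSL2:
  "(CARD('k) - 1) * CARD('k) ^ 2 \<le> 2 * card (carrier (PSL2 :: ('k::{field, finite} ^ 2 ^ 2) set monoid))"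
proof -
  let ?G = "PSL2 :: ('k ^ 2 ^ 2) set monoid"
  define T where "T = (- {0 :: 'k}) \<times> (UNIV :: 'k set) \<times> (UNIV :: 'k set)"
  define m where "m = (\<lambda>(x :: 'k, y, z). mat2 x y z ((1 + y * z) / x))"
  have "inj_on m T"
    by (rule inj_onI) (auto simp: m_def vec_eq_iff forall_2)
  then have "card T = card (m ` T)" by (simp add: card_image)
  also have "\<dots> \<le> card (\<Union> (carrier ?G))"
  proof (rule card_mono)
    show "m ` T \<subseteq> \<Union> (carrier ?G)"
    proof (rule image_subsetI)
      fix t assume "t \<in> T"
      then have "det (m t) = 1" by (auto simp: m_def T_def det_2 split: if_splits)
      then have "{m t, - m t} \<in> carrier ?G" by (rule PSL2_carrierI)
      then show "m t \<in> \<Union> (carrier ?G)" by (rule UnionI) simp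
    qed
  qed simp
  also have "\<dots> \<le> (\<Sum>C\<in>carrier ?G. card C)"
    by (rule card_Union_le_sum_card)
  also have "\<dots> \<le> (\<Sum>C\<in>carrier ?G. 2)"
    by (rule sum_mono) (auto elim!: PSL2_carrierE simp: card_insert_if)
  finally show ?thesis
    by (simp add: T_def card_cartesian_product Compl_eq_Diff_UNIV card_Diff_singleton power2_eq_square mult.commute)
qed

section \<open>Transfer from F7 to residues\<close>

definition residue7 :: "F7 \<Rightarrow> nat" where
  "residue7 x = nat (to_int_mod_ring x)"

lemma residue7_less: "residue7 x < 7"
  using range_to_int_mod_ring[where ?'a = seven] card_seven
  unfolding residue7_def by (metis atLeastLessThan_iff nat_less_iff of_nat_numeral rangeI)

lemma int_residue7: "int (residue7 x) = to_int_mod_ring x"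
  using range_to_int_mod_ring[where ?'a = seven] unfolding residue7_def
  by (metis atLeastLessThan_iff int_nat_eq rangeI)

lemma residue7_inject: "residue7 x = residue7 y \<longleftrightarrow> x = y"
  using int_residue7 by (metis of_int_mod_ring_to_int_mod_ring)

lemma residue7_0: "residue7 0 = 0" and residue7_1: "residue7 1 = 1"
  by (simp_all add: residue7_def)

lemma residue7_add: "residue7 (x + y) = (residue7 x + residue7 y) mod 7"
proof -
  have "int (residue7 (x + y)) = int ((residue7 x + residue7 y) mod 7)"
    unfolding int_residue7 of_nat_mod of_nat_add by (transfer) (simp add: card_seven)
  then show ?thesis by simp
qed

lemma residue7_mult: "residue7 (x * y) = (residue7 x * residue7 y) mod 7"
proof -
  have "int (residue7 (x * y)) = int ((residue7 x * residue7 y) mod 7)"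
    unfolding int_residue7 of_nat_mod of_nat_mult by (transfer) (simp add: card_seven)
  then show ?thesis by simp
qed

text \<open>The residues of \<open>x\<close> and \<open>- x\<close> add up to a multiple of 7 below
  14, hence to 0 or 7.\<close>

lemma residue7_uminus: "residue7 (- x) = neg7 (residue7 x)"
proof -
  have "(residue7 (- x) + residue7 x) mod 7 = 0"
    using residue7_add[of "- x" x] by (simp add: residue7_0)
  then have "residue7 (- x) + residue7 x = 0 \<or> residue7 (- x) + residue7 x = 7"
    using residue7_less[of x] residue7_less[of "- x"] by presburger
  then consider "residue7 x = 0" "residue7 (- x) = 0" | "7 - residue7 x = residue7 (- x)"
    by linarith
  then show ?thesis by cases (simp_all add: neg7_def residue7_less)
qed

lemma residue7_diff: "residue7 (x - y) = (residue7 x + neg7 (residue7 y)) mod 7"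
  using residue7_add[of x "- y"] by (simp add: residue7_uminus)

definition entries7 :: "F7 ^ 2 ^ 2 \<Rightarrow> nat \<times> nat \<times> nat \<times> nat" where
  "entries7 A = (residue7 (A$1$1), residue7 (A$1$2), residue7 (A$2$1), residue7 (A$2$2))"

lemma entries7_inject: "entries7 A = entries7 B \<longleftrightarrow> A = B"
  by (auto simp: entries7_def residue7_inject vec_eq_iff forall_2)

lemma first_column_nonzero:
  fixes A :: "F7 ^ 2 ^ 2"
  assumes "det A = 1"
  shows "residue7 (A$1$1) \<noteq> 0 \<or> residue7 (A$2$1) \<noteq> 0"
  using assms residue7_inject[of _ 0] by (auto simp: det_2 residue7_0)

lemma mem_matrices7:
  assumes "det A = 1" "normal7 (residue7 (A$1$1)) (residue7 (A$2$1))"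
  shows "entries7 A \<in> set matrices7"
proof -
  \<comment> \<open>The determinant equation is brought into the subtraction-free form tested in
    \<open>matrices7\<close>.\<close>
  have "A$1$1 * A$2$2 = 1 + A$1$2 * A$2$1"
    using assms(1) by (simp add: det_2 algebra_simps)
  then have "residue7 (A$1$1 * A$2$2) = residue7 (1 + A$1$2 * A$2$1)" by (rule arg_cong)
  then have "(residue7 (A$1$1) * residue7 (A$2$2)) mod 7 = (1 + residue7 (A$1$2) * residue7 (A$2$1)) mod 7"
    by (simp add: residue7_mult residue7_add residue7_1 mod_simps)
  moreover have "residue7 (A$2$1) < 4" using assms(2) by (auto simp: normal7_def)
  ultimately show ?thesis
    using assms(2) by (simp add: mem_matrices7I entries7_def residue7_less)
qed

lemma PSL2_carrierE_normal7:
  assumes "C \<in> carrier PSL2"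
  obtains A where "C = {A, - A}" "det A = 1" "normal7 (residue7 (A$1$1)) (residue7 (A$2$1))"
proof -
  obtain A where A: "C = {A, - A}" "det A = 1" using assms by (rule PSL2_carrierE)
  show thesis
  proof (cases "normal7 (residue7 (A$1$1)) (residue7 (A$2$1))")
    case True
    then show thesis using that A by blast
  next
    case False
    have "normal7 (residue7 ((- A)$1$1)) (residue7 ((- A)$2$1))"
      using False normal7_neg7 first_column_nonzero[OF A(2)]
      by (simp add: residue7_uminus residue7_less)
    moreover have "C = {- A, - (- A)}" "det (- A) = 1" using A by (auto simp: det_2)
    ultimately show thesis using that by blast
  qed
qed

section \<open>The value for PSL2(F7)\<close>

lemma chi1_PSL2_F7:
  "chi1 (PSL2 :: (F7 ^ 2 ^ 2) set monoid)
    [PSL2_elt neg_recip, PSL2_elt plus_one, inv\<^bsub>PSL2\<^esub> (PSL2_elt plus_one)] = 4"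
proof -
  let ?G = "PSL2 :: (F7 ^ 2 ^ 2) set monoid"
  define m where "m = (\<lambda>A :: F7 ^ 2 ^ 2. {A, - A})"
  define a b c :: "F7 ^ 2 ^ 2" where "a = mat2 0 (- 1) 1 0" "b = mat2 1 1 0 1" "c = mat2 1 (- 1) 0 1"
  note abc = this
  define l where "l = (\<lambda>A. case entries7 A of (x, y, z, w) \<Rightarrow> label7 x y z w)"
  \<comment> \<open>On a coset in the group \<open>l\<close> is constant, as \<open>lab\<close>
    shows, so the image is a singleton.\<close>
  define f where "f = (\<lambda>C. the_elem (l ` C))"
  have det: "det a = 1" "det b = 1" "det c = 1" by (simp_all add: abc det_2)
  have carrier: "m a \<in> carrier ?G" "m b \<in> carrier ?G" "m c \<in> carrier ?G"
    unfolding m_def using det by (simp_all add: PSL2_carrierI)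
  have lab: "f (m A) = l A" if "det A = 1" for A
  proof -
    have "l (- A) = l A"
      using label7_neg7 first_column_nonzero[OF that]
      by (simp add: l_def entries7_def residue7_uminus residue7_less)
    then show ?thesis by (simp add: f_def m_def)
  qed
  \<comment> \<open>Any representative will do: the products with generators may leave normal form,
    and \<open>label7\<close> normalizes them itself.\<close>
  have pattern: "f (m A) # map (\<lambda>s. f (m A \<otimes>\<^bsub>?G\<^esub> s)) [m a, m b, m c] = pattern7 (entries7 A)"
    if "det A = 1" for A
  proof -
    have "f (m A \<otimes>\<^bsub>?G\<^esub> m B) = l (A ** B)" if "det B = 1" for B
      using lab[of "A ** B"] \<open>det A = 1\<close> that by (simp add: m_def PSL2_mult det_mul)
    then show ?thesis using that det lab
      by (simp add: l_def entries7_def pattern7_def abc mult_mat2_nth residue7_uminus residue7_add residue7_diff add.commute)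
  qed
  have "separating_labelling ?G [m a, m b, m c] (Suc 3) f"
    unfolding separating_labelling_def
  proof (intro conjI inj_onI funcsetI)
    fix C assume C: "C \<in> carrier ?G"
    obtain A where A: "C = m A" "det A = 1" "normal7 (residue7 (A$1$1)) (residue7 (A$2$1))"
      using C unfolding m_def by (rule PSL2_carrierE_normal7)
    have "l A < 4" using label7_less mem_matrices7[OF A(2,3)] by (auto simp: list_all_iff l_def)
    then show "f C \<in> {0..<Suc 3}" using lab A by simp
  next
    fix C D assume C: "C \<in> carrier ?G" and D: "D \<in> carrier ?G"
      and eq: "(f C, map (\<lambda>s. f (C \<otimes>\<^bsub>?G\<^esub> s)) [m a, m b, m c]) = (f D, map (\<lambda>s. f (D \<otimes>\<^bsub>?G\<^esub> s)) [m a, m b, m c])"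
    \<comment> \<open>Normal representatives are chosen because distinctness of patterns is checked
      only on \<open>matrices7\<close>.\<close>
    obtain A where A: "C = m A" "det A = 1" "normal7 (residue7 (A$1$1)) (residue7 (A$2$1))"
      using C unfolding m_def by (rule PSL2_carrierE_normal7)
    obtain B where B: "D = m B" "det B = 1" "normal7 (residue7 (B$1$1)) (residue7 (B$2$1))"
      using D unfolding m_def by (rule PSL2_carrierE_normal7)
    have "pattern7 (entries7 A) = pattern7 (entries7 B)"
      using eq unfolding pattern[OF A(2), symmetric] pattern[OF B(2), symmetric] A(1) B(1) by simp
    moreover have "inj_on pattern7 (set matrices7)" using distinct_pattern7 by (simp add: distinct_map)
    ultimately have "entries7 A = entries7 B"
      using mem_matrices7 A(2,3) B(2,3) by (blast dest: inj_onD)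
    then show "C = D" using A(1) B(1) by (simp add: entries7_inject)
  qed
  \<comment> \<open>The bound reads 6 * 49 = 294 \<le> 2 |G|, so |G| is at least 147; this already
    exceeds 3^4 = 81.\<close>
  moreover have "3 ^ Suc (length [m a, m b, m c]) < card (carrier ?G)"
    using card_PSL2[where ?'k = F7] by (simp add: card_seven)
  ultimately have "chi1 ?G [m a, m b, m c] = Suc 3"
    by (rule chi1_eqI) (use carrier monoid.m_closed[OF monoid_PSL2] in auto)
  then show ?thesis
    unfolding PSL2_elt_neg_recip PSL2_elt_plus_one inv_PSL2_elt_plus_one by (simp add: m_def abc)
qed

theorem mainTheorem4:
  shows "(let G = alt_on {0, 1, 2, 3, 4 :: nat};
              a = cycle_of_list [0, 1] \<circ> cycle_of_list [2, 3];
              b = cycle_of_list [0, 1, 2, 3, 4]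
          in chi1 G [a, b, inv\<^bsub>G\<^esub> b] = 3) \<and>
         (let G = (PSL2 :: (F7 ^ 2 ^ 2) set monoid);
              a = PSL2_elt neg_recip;
              b = PSL2_elt plus_one
          in chi1 G [a, b, inv\<^bsub>G\<^esub> b] = 4)"
proof -
  have "{0, 1, 2, 3, 4} = {..<5 :: nat}" by auto
  then show ?thesis unfolding Let_def using chi1_alt5 chi1_PSL2_F7 by simp
qed

end
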